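(* Let $\Delta\geq3$ be an integer, and let $W_\Delta$ be the wheel graph with maximum degree $\Delta$. Then $s(W_\Delta)=\max\{5,\Delta\}$.
   Context: A vertex labeling of a graph $G$ is an injective map $f:V(G)\to\mathbb{Z}$. It induces the edge labeling $f^+:E(G)\to\mathbb{Z}$, $f^+(uv)=f(u)+f(v)$, and $|f^+|$ denotes the number of distinct values $f^+$ takes on $E(G)$. The sum index $s(G)$ is the minimum positive integer $k$ such that there exists a vertex labeling $f$ of $G$ with $|f^+|=k$. For an integer $\Delta\geq3$, the wheel $W_\Delta$ is the graph consisting of a center vertex $v_0$, a cycle $v_1v_2\dotsb v_\Delta v_1$, and the edges $v_0v_i$ for all $1\leq i\leq\Delta$. *)

theory Defs
  imports "Graph_Theory.Graph_Theory"
begin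

text \<open>
  A finite simple graph is a \<^locale>\<open>pair_graph\<close>: the undirected edge between \<open>u\<close> and \<open>v\<close> is
  represented by the two arcs \<open>(u, v)\<close> and \<open>(v, u)\<close>. Both arcs get the same value under
  \<open>edge_labeling\<close>, so it is a function of the undirected edge.
\<close>

definition vertex_labeling :: "'a pair_pre_digraph \<Rightarrow> ('a \<Rightarrow> int) \<Rightarrow> bool" where
  "vertex_labeling G f \<longleftrightarrow> inj_on f (pverts G)"

definition edge_labeling :: "('a \<Rightarrow> int) \<Rightarrow> 'a \<times> 'a \<Rightarrow> int" where
  "edge_labeling f = (\<lambda>(u, v). f u + f v)"

definition num_edge_labels :: "'a pair_pre_digraph \<Rightarrow> ('a \<Rightarrow> int) \<Rightarrow> nat" where
  "num_edge_labels G f = card (edge_labeling f ` parcs G)"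

text \<open>Meaningful only for graphs with at least one edge; otherwise no positive \<open>k\<close> exists.\<close>

definition sum_index :: "'a pair_pre_digraph \<Rightarrow> nat" where
  "sum_index G = (LEAST k. k > 0 \<and> (\<exists>f. vertex_labeling G f \<and> num_edge_labels G f = k))"

text \<open>The vertex \<open>i\<close> stands for \<open>v\<^sub>i\<close>; the center is \<open>0\<close> and the last pair closes the rim cycle.\<close>

definition wheel :: "nat \<Rightarrow> nat pair_pre_digraph" where
  "wheel n = mk_symmetric (with_proj
     \<lparr> pverts = {0..n},
       parcs = {(0, i) | i. 1 \<le> i \<and> i \<le> n} \<union> {(i, i + 1) | i. 1 \<le> i \<and> i < n} \<union> {(n, 1)} \<rparr>)"

lemma pverts_wheel: "pverts (wheel n) = {0..n}"
  by (simp add: wheel_def)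

lemma mem_parcs_wheel:
  "(u, v) \<in> parcs (wheel n) \<longleftrightarrow>
     u = 0 \<and> 1 \<le> v \<and> v \<le> n \<or> v = 0 \<and> 1 \<le> u \<and> u \<le> n \<or>
     1 \<le> u \<and> u < n \<and> v = u + 1 \<or> 1 \<le> v \<and> v < n \<and> u = v + 1 \<or>
     u = n \<and> v = 1 \<or> u = 1 \<and> v = n"
  by (auto simp: wheel_def parcs_mk_symmetric)

lemma pair_graph_wheel:
  assumes "3 \<le> n"
  shows "pair_graph (wheel n)"
proof -
  have sub: "parcs (wheel n) \<subseteq> {0..n} \<times> {0..n}"
    using assms by (auto simp: mem_parcs_wheel)
  show ?thesis
  proof
    show "finite (parcs (wheel n))"
      using finite_subset[OF sub] by simp
    show "symmetric (with_proj (wheel n))"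
      by (auto simp: symmetric_def sym_def mem_parcs_wheel)
    show "fst e \<noteq> snd e" if "e \<in> parcs (wheel n)" for e
      using that assms by (cases e) (auto simp: mem_parcs_wheel)
  qed (use sub in \<open>auto simp: pverts_wheel\<close>)
qed

lemma max_degree_wheel:
  assumes "3 \<le> n"
  shows "Max (out_degree (with_proj (wheel n)) ` pverts (wheel n)) = n"
proof (rule Max_eqI)
  have center: "out_arcs (with_proj (wheel n)) 0 = Pair 0 ` {1..n}"
    using assms by (auto simp: out_arcs_def mem_parcs_wheel image_iff)
  have deg0: "out_degree (with_proj (wheel n)) 0 = n"
    unfolding out_degree_def center by (subst card_image) (auto simp: inj_on_def)
  then show "n \<in> out_degree (with_proj (wheel n)) ` pverts (wheel n)"
    by (auto simp: pverts_wheel image_iff intro!: bexI[of _ 0])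
  show "d \<le> n" if d: "d \<in> out_degree (with_proj (wheel n)) ` pverts (wheel n)" for d
  proof -
    obtain v where v: "v \<le> n" "d = out_degree (with_proj (wheel n)) v"
      using d by (auto simp: pverts_wheel)
    show ?thesis
    proof (cases "v = 0")
      case True
      then show ?thesis using v deg0 by simp
    next
      case False
      let ?S = "{(v, 0), (v, if v = n then 1 else v + 1), (v, if v = 1 then n else v - 1)}"
      have "out_arcs (with_proj (wheel n)) v \<subseteq> ?S"
        using False assms by (auto simp: out_arcs_def mem_parcs_wheel)
      then have "d \<le> card ?S"
        unfolding v(2) out_degree_def by (intro card_mono) auto
      also have "\<dots> \<le> 3"
        by (auto simp: card_insert_if)
      finally show ?thesis using assms by simp
    qed
  qed
qed (simp add: pverts_wheel)

end

theory Submission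
  imports Defs
begin

text \<open>
  The spokes alone carry \<open>n\<close> distinct labels, because they share the center.  A rim edge \<open>uv\<close> can
  only repeat the label of a spoke to another rim vertex \<open>w\<close>, in which case \<open>f u + f v = f 0 + f w\<close>.
  For \<open>n = 3\<close> at most one of the three rim edges does this, and for \<open>n = 4\<close> at most three of the
  four do, since otherwise these linear equations force two vertex labels to coincide.  Hence at
  least five labels occur in these two cases, which gives \<open>num_edge_labels_wheel_ge\<close>.

  For the upper bound, give the center the label \<open>0\<close>; the spoke labels are then the rim vertex
  labels themselves.  Use on the rim the nonzero integers from \<open>-\<lfloor>n/2\<rfloor>\<close> to \<open>\<lceil>n/2\<rceil>\<close>.
  Where signs alternate around the rim, sums of neighbors stay in this interval, and a sum is
  nonzero as long as \<open>x\<close> and \<open>-x\<close> are not adjacent.  The order \<open>-1, 3, -2, 4, -3, 5, \<dots>\<close>, whose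
  sums of neighbors are \<open>2\<close> and \<open>1\<close>, achieves this; the numbers \<open>1\<close> and \<open>2\<close>, which it leaves out,
  go near the end and close the cycle (\<open>wheel_labeling_rim_bounds\<close>).  So for \<open>n \<ge> 5\<close> the rim
  edges add no label to those of the spokes.  For \<open>n = 3\<close> and \<open>n = 4\<close> the same recipe gives the rims
  \<open>-1, 1, 2\<close> and \<open>-1, 1, -2, 2\<close>, whose edge labels are the five integers from \<open>-1\<close> to \<open>3\<close> and from
  \<open>-2\<close> to \<open>2\<close>, respectively.
\<close>

section \<open>Edge labels of the wheel\<close>

lemma edge_label_wheel:
  "(u, v) \<in> parcs (wheel n) \<Longrightarrow> f u + f v \<in> edge_labeling f ` parcs (wheel n)"
  by (force simp: edge_labeling_def)

lemma edge_labels_wheel: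
  assumes "n \<ge> 3"
  shows "edge_labeling f ` parcs (wheel n) =
    (\<lambda>i. f 0 + f i) ` {1..n} \<union> (\<lambda>i. f i + f (if i = n then 1 else i + 1)) ` {1..n}"
    (is "?L = ?A \<union> ?B")
proof (intro equalityI subsetI)
  fix x
  assume "x \<in> ?L"
  then obtain u v where uv: "(u, v) \<in> parcs (wheel n)" and x: "x = f u + f v"
    by (auto simp: edge_labeling_def)
  have "u = 0 \<and> v \<in> {1..n} \<or> v = 0 \<and> u \<in> {1..n} \<or>
      u \<in> {1..n} \<and> v = (if u = n then 1 else u + 1) \<or>
      v \<in> {1..n} \<and> u = (if v = n then 1 else v + 1)"
    using uv assms unfolding mem_parcs_wheel by (elim disjE) simp_all
  then consider "u = 0" "v \<in> {1..n}" | "v = 0" "u \<in> {1..n}"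
    | "u \<in> {1..n}" "v = (if u = n then 1 else u + 1)"
    | "v \<in> {1..n}" "u = (if v = n then 1 else v + 1)"
    by blast
  then show "x \<in> ?A \<union> ?B"
    unfolding x
  proof cases
    case 2
    then show "f u + f v \<in> ?A \<union> ?B" by (simp add: add.commute)
  next
    case 4
    then have "f v + f u \<in> ?B" by blast
    then have "f u + f v \<in> ?B" by (simp only: add.commute[of "f u"])
    then show "f u + f v \<in> ?A \<union> ?B" by (rule UnI2)
  qed blast+
next
  fix x
  assume "x \<in> ?A \<union> ?B"
  then show "x \<in> ?L"
    using assms by (auto intro!: edge_label_wheel simp: mem_parcs_wheel)
qed

lemma finite_edge_labels_wheel: "n \<ge> 3 \<Longrightarrow> finite (edge_labeling f ` parcs (wheel n))"
  by (simp add: edge_labels_wheel)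

section \<open>Lower bound\<close>

text \<open>Spokes share the center, so injectivity on the rim makes their labels distinct.\<close>

lemma num_edge_labels_wheel_ge_spokes:
  assumes "n \<ge> 3" and "vertex_labeling (wheel n) f"
  shows "n \<le> num_edge_labels (wheel n) f"
proof -
  have "card ((\<lambda>i. f 0 + f i) ` {1..n}) = n"
    using assms(2)
    by (subst card_image) (auto simp: vertex_labeling_def pverts_wheel inj_on_def)
  moreover have "(\<lambda>i. f 0 + f i) ` {1..n} \<subseteq> edge_labeling f ` parcs (wheel n)"
    by (auto intro!: edge_label_wheel simp: mem_parcs_wheel)
  ultimately show ?thesis
    unfolding num_edge_labels_def
    using card_mono finite_edge_labels_wheel[OF assms(1)] by metis
qed

text \<open>
  Two rim edges \<open>uv\<close> and \<open>uw\<close> of the triangle cannot both repeat a spoke label: adding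
  \<open>f u + f v = f 0 + f w\<close> and \<open>f u + f w = f 0 + f v\<close> gives \<open>f u = f 0\<close>.
\<close>

lemma num_edge_labels_wheel_3:
  assumes "vertex_labeling (wheel 3) f"
  shows "5 \<le> num_edge_labels (wheel 3) f"
proof -
  let ?L = "edge_labeling f ` parcs (wheel 3)"
  have "inj_on f {0, 1, 2, 3}"
    using assms unfolding vertex_labeling_def pverts_wheel by (rule inj_on_subset) auto
  then have ne: "f 0 \<noteq> f 1" "f 0 \<noteq> f 2" "f 0 \<noteq> f 3" "f 1 \<noteq> f 2" "f 1 \<noteq> f 3" "f 2 \<noteq> f 3"
    by (simp_all add: inj_on_def)
  have L: "f 0 + f 1 \<in> ?L" "f 0 + f 2 \<in> ?L" "f 0 + f 3 \<in> ?L"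
    "f 1 + f 2 \<in> ?L" "f 1 + f 3 \<in> ?L" "f 2 + f 3 \<in> ?L"
    by (rule edge_label_wheel; simp add: mem_parcs_wheel)+
  have five: "5 \<le> card ?L"
    if "x \<in> ?L" "y \<in> ?L" "x \<noteq> y" "x \<notin> {f 0 + f 1, f 0 + f 2, f 0 + f 3}"
      "y \<notin> {f 0 + f 1, f 0 + f 2, f 0 + f 3}" for x y
  proof -
    have "card {f 0 + f 1, f 0 + f 2, f 0 + f 3, x, y} = 5"
      using ne that by auto
    moreover have "{f 0 + f 1, f 0 + f 2, f 0 + f 3, x, y} \<subseteq> ?L"
      using L that by blast
    ultimately show ?thesis
      using card_mono finite_edge_labels_wheel[of 3] by (metis order_refl)
  qed
  consider "f 1 + f 2 = f 0 + f 3" | "f 1 + f 3 = f 0 + f 2"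
    | "f 1 + f 2 \<noteq> f 0 + f 3" "f 1 + f 3 \<noteq> f 0 + f 2" by blast
  then have "5 \<le> card ?L"
  proof cases
    case 1
    then show ?thesis using five[OF L(5,6)] ne by auto
  next
    case 2
    then show ?thesis using five[OF L(4,6)] ne by auto
  next
    case 3
    then show ?thesis using five[OF L(4,5)] ne by auto
  qed
  then show ?thesis by (simp add: num_edge_labels_def)
qed

text \<open>
  With \<open>x i = f i - f 0\<close>, if all four rim labels repeat spoke labels, then each sum of two
  neighbors is one of the other two numbers.  Say \<open>x 1 + x 2 = x 3\<close>.  Then \<open>x 2 + x 3\<close> is not
  \<open>x 1\<close>, since \<open>x 2 \<noteq> 0\<close>, so it is \<open>x 4\<close>, and so on around the rim: every sum of neighbors is the
  next number.  That system has only the zero solution.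
\<close>

lemma num_edge_labels_wheel_4:
  assumes "vertex_labeling (wheel 4) f"
  shows "5 \<le> num_edge_labels (wheel 4) f"
proof -
  let ?L = "edge_labeling f ` parcs (wheel 4)"
  let ?S = "{f 0 + f 1, f 0 + f 2, f 0 + f 3, f 0 + f 4}"
  have "inj_on f {0, 1, 2, 3, 4}"
    using assms unfolding vertex_labeling_def pverts_wheel by (rule inj_on_subset) auto
  then have ne: "f 0 \<noteq> f 1" "f 0 \<noteq> f 2" "f 0 \<noteq> f 3" "f 0 \<noteq> f 4" "f 1 \<noteq> f 2" "f 1 \<noteq> f 3"
    "f 1 \<noteq> f 4" "f 2 \<noteq> f 3" "f 2 \<noteq> f 4" "f 3 \<noteq> f 4"
    by (simp_all add: inj_on_def)
  have L: "?S \<subseteq> ?L"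
    by (auto intro!: edge_label_wheel simp: mem_parcs_wheel)
  have rim: "{f 1 + f 2, f 2 + f 3, f 3 + f 4, f 4 + f 1} \<subseteq> ?L"
    by (auto intro!: edge_label_wheel simp: mem_parcs_wheel)
  have "\<not> {f 1 + f 2, f 2 + f 3, f 3 + f 4, f 4 + f 1} \<subseteq> ?S"
  proof
    assume "{f 1 + f 2, f 2 + f 3, f 3 + f 4, f 4 + f 1} \<subseteq> ?S"
    then have rep: "f 1 + f 2 = f 0 + f 3 \<or> f 1 + f 2 = f 0 + f 4"
      "f 2 + f 3 = f 0 + f 4 \<or> f 2 + f 3 = f 0 + f 1"
      "f 3 + f 4 = f 0 + f 1 \<or> f 3 + f 4 = f 0 + f 2"
      "f 4 + f 1 = f 0 + f 2 \<or> f 4 + f 1 = f 0 + f 3"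
      using ne by auto
    from rep(1) show False
    proof
      assume 1: "f 1 + f 2 = f 0 + f 3"
      have 2: "f 2 + f 3 = f 0 + f 4" using rep(2) 1 ne(2) by linarith
      have 3: "f 3 + f 4 = f 0 + f 1" using rep(3) 2 ne(3) by linarith
      have 4: "f 4 + f 1 = f 0 + f 2" using rep(4) 3 ne(4) by linarith
      show False using 1 2 3 4 ne(1) by linarith
    next
      (* the same argument, going around the rim in the other direction *)
      assume 1: "f 1 + f 2 = f 0 + f 4"
      have 4: "f 4 + f 1 = f 0 + f 3" using rep(4) 1 ne(1) by linarith
      have 3: "f 3 + f 4 = f 0 + f 2" using rep(3) 4 ne(4) by linarith
      have 2: "f 2 + f 3 = f 0 + f 1" using rep(2) 3 ne(3) by linarith
      show False using 1 2 3 4 ne(2) by linarith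
    qed
  qed
  then obtain x where x: "x \<in> ?L" "x \<notin> ?S"
    using rim by blast
  have "5 = card (insert x ?S)"
    using ne x by auto
  also have "\<dots> \<le> card ?L"
    using L x by (intro card_mono) (auto simp: finite_edge_labels_wheel)
  finally show ?thesis by (simp add: num_edge_labels_def)
qed

lemma num_edge_labels_wheel_ge:
  assumes "n \<ge> 3" and "vertex_labeling (wheel n) f"
  shows "max 5 n \<le> num_edge_labels (wheel n) f"
proof -
  consider "n = 3" | "n = 4" | "n \<ge> 5" using assms(1) by linarith
  then show ?thesis
    using assms num_edge_labels_wheel_3 num_edge_labels_wheel_4 num_edge_labels_wheel_ge_spokes
    by cases auto
qed

section \<open>An optimal labeling\<close>

text \<open>
  Around the rim this reads \<open>-1, 3, -2, 4, \<dots>, -k, 1, 2\<close> for \<open>n = 2 * k + 1\<close> and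
  \<open>-1, 3, -2, 4, \<dots>, -(k - 1), 1, -k, 2\<close> for \<open>n = 2 * k\<close>.
\<close>

definition wheel_labeling :: "nat \<Rightarrow> nat \<Rightarrow> int" where
  "wheel_labeling n i =
    (if i = 0 then 0 else if i = n then 2
     else if odd i then - int ((i + 1) div 2)
     else if n \<le> i + 2 then 1
     else int (i div 2 + 2))"

lemma vertex_labeling_wheel_labeling: "vertex_labeling (wheel n) (wheel_labeling n)"
  unfolding vertex_labeling_def pverts_wheel
proof (rule inj_onI)
  fix i j
  assume "i \<in> {0..n}" "j \<in> {0..n}" "wheel_labeling n i = wheel_labeling n j"
  then show "i = j"
    by (cases "even i"; cases "even j")
      (auto simp: wheel_labeling_def elim!: evenE oddE split: if_splits)
qed

lemma wheel_labeling_bounds: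
  assumes "n \<ge> 3" and "1 \<le> i" and "i \<le> n"
  shows "wheel_labeling n i \<in> {- int (n div 2)..int ((n + 1) div 2)} - {0}"
  using assms
  by (cases "even i"; cases "even n")
    (auto simp: wheel_labeling_def elim!: evenE oddE)

text \<open>
  Along the initial stretch \<open>-1, 3, -2, 4, \<dots>\<close> the sums are \<open>1\<close> and \<open>2\<close>.  The rim edges at the
  vertices labeled \<open>1\<close> and \<open>2\<close> near the end have labels among \<open>1\<close>, \<open>3\<close>, \<open>1 - \<lfloor>n/2\<rfloor>\<close>, \<open>2 - \<lfloor>n/2\<rfloor>\<close>, which
  lie in the range and are nonzero once \<open>n \<ge> 5\<close>.
\<close>

lemma wheel_labeling_rim_bounds:
  assumes "n \<ge> 5" and "1 \<le> i" and "i \<le> n"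
  shows "wheel_labeling n i + wheel_labeling n (if i = n then 1 else i + 1)
    \<in> {- int (n div 2)..int ((n + 1) div 2)} - {0}"
  using assms
  by (cases "even i"; cases "even n")
    (auto simp: wheel_labeling_def elim!: evenE oddE)

lemma num_edge_labels_wheel_labeling:
  assumes "n \<ge> 3"
  shows "num_edge_labels (wheel n) (wheel_labeling n) \<le> max 5 n"
proof -
  let ?f = "wheel_labeling n"
  define A where "A = (\<lambda>i. ?f 0 + ?f i) ` {1..n} \<union>
    (\<lambda>i. ?f i + ?f (if i = n then 1 else i + 1)) ` {1..n}"
  have "card A \<le> max 5 n"
  proof -
    consider "n = 3" | "n = 4" | "n \<ge> 5" using assms by linarith
    then show ?thesis
    proof cases
      case 1
      have "{1..n} = {1, 2, 3}" using 1 by auto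
      then have "A \<subseteq> {-1..3}" using 1 by (simp add: A_def wheel_labeling_def)
      from card_mono[OF _ this] show ?thesis by simp
    next
      case 2
      have "{1..n} = {1, 2, 3, 4}" using 2 by auto
      then have "A \<subseteq> {-2..2}" using 2 by (simp add: A_def wheel_labeling_def)
      from card_mono[OF _ this] show ?thesis by simp
    next
      case 3
      have "A \<subseteq> {- int (n div 2)..int ((n + 1) div 2)} - {0}"
        unfolding A_def using 3 wheel_labeling_bounds[of n] wheel_labeling_rim_bounds[of n]
        by (simp add: image_subset_iff wheel_labeling_def[of n 0])
      moreover have "card ({- int (n div 2)..int ((n + 1) div 2)} - {0}) = n"
        by simp
      ultimately show ?thesis
        using card_mono[of "{- int (n div 2)..int ((n + 1) div 2)} - {0}" A] by simp
    qed
  qed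
  then show ?thesis
    by (simp only: num_edge_labels_def A_def edge_labels_wheel[OF assms])
qed

theorem theorem2p11:
  fixes \<Delta> :: nat
  assumes "\<Delta> \<ge> 3"
  shows "sum_index (wheel \<Delta>) = max 5 \<Delta>"
  unfolding sum_index_def
proof (rule Least_equality)
  have "num_edge_labels (wheel \<Delta>) (wheel_labeling \<Delta>) = max 5 \<Delta>"
    using num_edge_labels_wheel_labeling num_edge_labels_wheel_ge
      vertex_labeling_wheel_labeling assms by (intro antisym) auto
  then show "0 < max 5 \<Delta> \<and>
      (\<exists>f. vertex_labeling (wheel \<Delta>) f \<and> num_edge_labels (wheel \<Delta>) f = max 5 \<Delta>)"
    using vertex_labeling_wheel_labeling[of \<Delta>] by auto
  show "max 5 \<Delta> \<le> k"
    if "0 < k \<and> (\<exists>f. vertex_labeling (wheel \<Delta>) f \<and> num_edge_labels (wheel \<Delta>) f = k)" for k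
    using that num_edge_labels_wheel_ge[OF assms] by blast
qed

end
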